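(* Let $p\ge1$, $r\ge1$, $n\ge1$ be integers, let $a,b\in\mathbb{R}^n$ with $y=\sum_{i=1}^n a_ib_i\ne0$, and let $\widehat{y}$ be the result of computing the inner product $y$ with limited-precision stochastic rounding $\mathrm{SR}_{p,r}$: $\widehat{t}_k=\mathrm{SR}_{p,r}(a_kb_k)$ for $k=1,\ldots,n$, $\widehat{s}_1=\widehat{t}_1$, $\widehat{s}_k=\mathrm{SR}_{p,r}(\widehat{s}_{k-1}+\widehat{t}_k)$ for $k=2,\ldots,n$, and $\widehat{y}=\widehat{s}_n$. Then $$\frac{|\mathbb{E}(\widehat{y})-y|}{|y|}\le \kappa(a\circ b)\,\gamma_n(u_{p+r}).$$
   Context: Notation: $u_q=2^{1-q}$ for an integer $q\ge1$; $\gamma_m(u)=(1+u)^m-1$; $a\circ b=(a_1b_1,\ldots,a_nb_n)$ is the Hadamard product and $\kappa(a\circ b)=\dfrac{\sum_{i=1}^n|a_ib_i|}{\left|\sum_{i=1}^n a_ib_i\right|}$ is the condition number of the inner product. Floating-point numbers: $\mathcal{F}$ is the precision-$p$ binary floating-point system, i.e. the set of $0$ and all real numbers $(-1)^s 2^e m$ with $s\in\{0,1\}$, $e$ an integer exponent, and $m\in[1,2)$ having at most $p$ significant bits. Standard model: no underflow or overflow occurs (the exponent range may be regarded as unlimited). For $x\in\mathbb{R}$, $\lceil x\rceil_p=\min\{y\in\mathcal{F}:y\ge x\}$ and $\lfloor x\rfloor_p=\max\{y\in\mathcal{F}:y\le x\}$. For $x\neq0$ written uniquely as $x=(-1)^s2^em$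 with $m\in[1,2)$ real, $\mathrm{ulp}_p(x)=2^{e-p+1}$, and $\mathrm{fl}_{p+r}(x)$ is $x$ with the binary expansion of its significand $m$ truncated to the first $p+r$ significant bits; $\mathrm{fl}_{p+r}(0)=0$. Limited-precision stochastic rounding with $r$ random bits: $\mathrm{SR}_{p,r}(0)=0$, and for $x\ne0$, $\mathrm{SR}_{p,r}(x)$ is the random variable equal to $\lceil x\rceil_p$ with probability $q_r(x)$ and to $\lfloor x\rfloor_p$ with probability $1-q_r(x)$, where $q_r(x)=(\mathrm{fl}_{p+r}(x)-\lfloor x\rfloor_p)/\mathrm{ulp}_p(x)$. In an algorithm, the inputs are deterministic and each rounding, conditionally on all previous roundings, has this two-point distribution with $x$ the exact result of the current operation. *)

theory Defs
  imports "HOL-Probability.Probability"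
begin

definition unit_roundoff :: "nat \<Rightarrow> real" where
  "unit_roundoff q = 2 powi (1 - int q)"

definition gamma_err :: "nat \<Rightarrow> real \<Rightarrow> real" where
  "gamma_err m u = (1 + u) ^ m - 1"

text \<open>A vector of \<open>\<real>\<^sup>n\<close> is a function \<open>nat \<Rightarrow> real\<close> of which only the values at \<open>1, \<dots>, n\<close> are used.\<close>

definition hadamard :: "(nat \<Rightarrow> real) \<Rightarrow> (nat \<Rightarrow> real) \<Rightarrow> nat \<Rightarrow> real" where
  "hadamard a b = (\<lambda>i. a i * b i)"

definition cond_number :: "nat \<Rightarrow> (nat \<Rightarrow> real) \<Rightarrow> real" where
  "cond_number n c = (\<Sum>i=1..n. \<bar>c i\<bar>) / \<bar>\<Sum>i=1..n. c i\<bar>"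

text \<open>For \<open>1 \<le> m < 2\<close>, having at most \<open>p\<close> significant bits means having at most \<open>p - 1\<close>
  bits after the binary point, that is, \<open>m * 2 ^ (p - 1)\<close> is an integer.\<close>

definition fp_system :: "nat \<Rightarrow> real set" where
  "fp_system p = insert 0
     {(-1) ^ s * 2 powi e * m | (s::nat) (e::int) (m::real).
        s \<in> {0, 1} \<and> 1 \<le> m \<and> m < 2 \<and> m * 2 ^ (p - 1) \<in> \<int>}"

definition round_up :: "nat \<Rightarrow> real \<Rightarrow> real" where
  "round_up p x = (LEAST y. y \<in> fp_system p \<and> x \<le> y)"

definition round_down :: "nat \<Rightarrow> real \<Rightarrow> real" where
  "round_down p x = (GREATEST y. y \<in> fp_system p \<and> y \<le> x)"

text \<open>Exponent and significand of a nonzero real; the lemmas \<open>binary_repr\<close> and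
  \<open>binary_repr_unique\<close> state that they are those of the unique binary representation.\<close>

definition expo :: "real \<Rightarrow> int" where
  "expo x = \<lfloor>log 2 \<bar>x\<bar>\<rfloor>"

definition signif :: "real \<Rightarrow> real" where
  "signif x = \<bar>x\<bar> / 2 powi expo x"

definition ulp :: "nat \<Rightarrow> real \<Rightarrow> real" where
  "ulp p x = 2 powi (expo x - int p + 1)"

text \<open>Truncation of the significand to \<open>q\<close> bits, one before and \<open>q - 1\<close> after the binary point,
  hence rounding towards zero.\<close>

definition fl_trunc :: "nat \<Rightarrow> real \<Rightarrow> real" where
  "fl_trunc q x = (if x = 0 then 0
     else sgn x * 2 powi expo x * (of_int \<lfloor>signif x * 2 ^ (q - 1)\<rfloor> / 2 ^ (q - 1)))"

definition sr_prob :: "nat \<Rightarrow> nat \<Rightarrow> real \<Rightarrow> real" where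
  "sr_prob p r x = (fl_trunc (p + r) x - round_down p x) / ulp p x"

text \<open>The parameter of \<open>bernoulli_pmf\<close> is clipped to \<open>[0, 1]\<close>; by the lemma \<open>sr_prob_bounds\<close>
  this has no effect here.\<close>

definition SR :: "nat \<Rightarrow> nat \<Rightarrow> real \<Rightarrow> real pmf" where
  "SR p r x = (if x = 0 then return_pmf 0
     else map_pmf (\<lambda>up. if up then round_up p x else round_down p x)
            (bernoulli_pmf (sr_prob p r x)))"

text \<open>The law of the partial sum \<open>s\<^sub>k\<close>. Since the law of each rounding, given all previous ones,
  depends only on the exact result of the current operation, it is a monadic composition.
  The value at \<open>0\<close> is immaterial. The recursion does not start from \<open>s\<^sub>0 = 0\<close>, as
  \<open>s\<^sub>1 = t\<^sub>1\<close> involves no addition.\<close>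

fun sr_inner :: "nat \<Rightarrow> nat \<Rightarrow> (nat \<Rightarrow> real) \<Rightarrow> (nat \<Rightarrow> real) \<Rightarrow> nat \<Rightarrow> real pmf" where
  "sr_inner p r a b 0 = return_pmf 0"
| "sr_inner p r a b (Suc 0) = SR p r (a 1 * b 1)"
| "sr_inner p r a b (Suc (Suc k)) =
     bind_pmf (sr_inner p r a b (Suc k)) (\<lambda>s.
     bind_pmf (SR p r (a (Suc (Suc k)) * b (Suc (Suc k)))) (\<lambda>t.
     SR p r (s + t)))"

lemma powi_expo_bounds:
  assumes "x \<noteq> 0"
  shows "2 powi expo x \<le> \<bar>x\<bar>" "\<bar>x\<bar> < 2 powi (expo x + 1)"
proof -
  have pos: "\<bar>x\<bar> > 0" using assms by simp
  have l: "real_of_int (expo x) \<le> log 2 \<bar>x\<bar>" "log 2 \<bar>x\<bar> < real_of_int (expo x + 1)"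
    unfolding expo_def by linarith+
  show "2 powi expo x \<le> \<bar>x\<bar>"
    using l(1) pos by (simp add: le_log_iff flip: powr_real_of_int')
  show "\<bar>x\<bar> < 2 powi (expo x + 1)"
    using l(2) pos by (simp add: log_less_iff flip: powr_real_of_int')
qed

lemma binary_repr:
  assumes "x \<noteq> 0"
  shows "x = (-1) ^ (if x < 0 then 1 else 0) * 2 powi expo x * signif x"
    and "1 \<le> signif x" "signif x < 2"
  using assms powi_expo_bounds[OF assms]
  by (auto simp: signif_def field_simps power_int_add)

lemma binary_repr_unique:
  assumes x: "x = (-1) ^ s * 2 powi e * m" and m: "1 \<le> m" "m < 2"
  shows "expo x = e" "signif x = m"
proof -
  have ax: "\<bar>x\<bar> = 2 powi e * m" using x m by (simp add: abs_mult power_abs)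
  have pos: "\<bar>x\<bar> > 0" using ax m by simp
  have "2 powi e \<le> \<bar>x\<bar>" using m ax by simp
  moreover have "\<bar>x\<bar> < 2 powi (e + 1)" using m ax by (simp add: power_int_add)
  ultimately have "real_of_int e \<le> log 2 \<bar>x\<bar>" "log 2 \<bar>x\<bar> < real_of_int (e + 1)"
    using pos by (simp_all add: le_log_iff log_less_iff flip: powr_real_of_int')
  then show e: "expo x = e" unfolding expo_def by linarith
  show "signif x = m" using ax by (simp add: signif_def e)
qed

lemma int_multiple_in_fp_system:
  assumes p: "p \<ge> 1" and k: "\<bar>k\<bar> \<le> 2 ^ p"
  shows "real_of_int k * 2 powi e \<in> fp_system p"
proof (cases "k = 0")
  case True
  then show ?thesis by (simp add: fp_system_def)
next
  case False
  let ?k = "real_of_int k"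
  have k0: "?k \<noteq> 0" using False by simp
  note repr = binary_repr[OF k0]
  have "0 \<le> log 2 \<bar>?k\<bar>" using False by simp
  then have E0: "0 \<le> expo ?k" by (simp add: expo_def)
  have "\<bar>?k\<bar> = real_of_int \<bar>k\<bar>" by simp
  also have "\<dots> \<le> real_of_int (2 ^ p)" using k by (simp only: of_int_le_iff)
  finally have kp: "\<bar>?k\<bar> \<le> 2 powi int p" by (simp add: power_int_of_nat)
  have "2 powi expo ?k \<le> (2::real) powi int p"
    using powi_expo_bounds(1)[OF k0] kp by linarith
  then have Ep: "expo ?k \<le> int p" using power_int_strict_increasing[of "int p" "expo ?k" "2::real"]
    by fastforce
  have int: "signif ?k * 2 ^ (p - 1) \<in> \<int>"
  proof (cases "expo ?k = int p")
    case True
    then have "signif ?k \<le> 1" using kp by (simp add: signif_def)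
    then have "signif ?k = 1" using repr(2) by simp
    then show ?thesis by simp
  next
    case False
    then have "expo ?k \<le> int (p - 1)" using Ep p by linarith
    moreover obtain j where j: "expo ?k = int j" using E0 nonneg_int_cases by blast
    ultimately have "j \<le> p - 1" by simp
    then have "(2::real) ^ (p - 1) = 2 ^ (p - 1 - j) * 2 ^ j" by (simp flip: power_add)
    then have "signif ?k * 2 ^ (p - 1) = real_of_int (\<bar>k\<bar> * 2 ^ (p - 1 - j))"
      by (simp add: signif_def j power_int_of_nat)
    then show ?thesis by (metis Ints_of_int)
  qed
  have "?k * 2 powi e = (-1) ^ (if ?k < 0 then 1 else 0) * 2 powi (expo ?k + e) * signif ?k"
    by (subst repr(1)) (simp add: power_int_add)
  then show ?thesis
    unfolding fp_system_def using repr(2,3) int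
    by (intro insertI2[OF CollectI] exI conjI) (assumption | simp)+
qed

lemma fp_system_int_multiple:
  assumes p: "p \<ge> 1" and y: "y \<in> fp_system p" and e: "2 powi e \<le> \<bar>y\<bar>"
  obtains k :: int where "y = of_int k * 2 powi (e - int p + 1)"
proof -
  have "0 < (2::real) powi e" by simp
  then have "0 < \<bar>y\<bar>" using e by linarith
  then have y0: "y \<noteq> 0" by simp
  obtain s :: nat and E m where
    yE: "y = (-1) ^ s * 2 powi E * m" and m: "1 \<le> m" "m < 2" "m * 2 ^ (p - 1) \<in> \<int>"
    using y y0 by (auto simp: fp_system_def)
  have E: "expo y = E" by (rule binary_repr_unique[OF yE m(1,2)])
  have "2 powi e < (2::real) powi (E + 1)"
    using e powi_expo_bounds(2)[OF y0] E by simp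
  then have "e \<le> E" using power_int_increasing[of "E + 1" e "2::real"] by fastforce
  then obtain d where d: "E = e + int d" using zle_iff_zadd by blast
  obtain i where i: "m * 2 ^ (p - 1) = of_int i" using m(3) by (elim Ints_cases)
  have ep: "e - int p + 1 = e - int (p - 1)" using p by simp
  have "m = of_int i / 2 ^ (p - 1)" using i by (simp add: field_simps)
  then have "y = of_int ((-1) ^ s * 2 ^ d * i) * 2 powi (e - int p + 1)"
    unfolding ep by (simp add: yE d power_int_add power_int_diff power_int_of_nat)
  then show ?thesis by (rule that)
qed

lemma
  assumes p: "p \<ge> 1" and x: "x \<noteq> 0"
  shows round_down_eq: "round_down p x = of_int \<lfloor>x / ulp p x\<rfloor> * ulp p x"
    and round_up_eq: "round_up p x = of_int \<lceil>x / ulp p x\<rceil> * ulp p x"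
proof -
  define u where "u = ulp p x"
  define B :: int where "B = 2 ^ (p - 1)"
  have u: "u > 0" by (simp add: u_def ulp_def)
  have ep: "expo x - int p + 1 = expo x - int (p - 1)" using p by simp
  have Bu: "real_of_int B * u = 2 powi expo x"
    unfolding u_def ulp_def ep by (simp add: B_def power_int_diff power_int_of_nat)
  have B2: "2 * B = 2 ^ p" using p by (cases p) (auto simp: B_def)
  have lo: "real_of_int B * u \<le> \<bar>x\<bar>" and hi: "\<bar>x\<bar> < real_of_int (2 * B) * u"
    using powi_expo_bounds[OF x] Bu by (auto simp: power_int_add)
  have mem: "of_int k * u \<in> fp_system p" if "\<bar>k\<bar> \<le> 2 * B" for k
    unfolding u_def ulp_def using that B2 by (intro int_multiple_in_fp_system p) simp
  have mult: "\<exists>k. y = of_int k * u" if "y \<in> fp_system p" "real_of_int B * u \<le> \<bar>y\<bar>" for y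
    using fp_system_int_multiple[OF p that(1), of "expo x"] that(2)
    unfolding Bu by (auto simp: u_def ulp_def)
  have xz: "\<bar>x / u\<bar> < real_of_int (2 * B)" "real_of_int B \<le> \<bar>x / u\<bar>"
    using lo hi u by (simp_all add: field_simps)
  have kb: "\<bar>\<lfloor>x / u\<rfloor>\<bar> \<le> 2 * B" "\<bar>\<lceil>x / u\<rceil>\<bar> \<le> 2 * B"
    using xz(1) by linarith+
  have dn: "y \<le> of_int \<lfloor>x / u\<rfloor> * u" if y: "y \<in> fp_system p" "y \<le> x" for y
  proof (cases "real_of_int B * u \<le> \<bar>y\<bar>")
    case True
    then obtain k where k: "y = of_int k * u" using mult y(1) by blast
    then have "real_of_int k \<le> x / u" using y(2) u by (simp add: field_simps)
    then show ?thesis using k u by (simp add: le_floor_iff)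
  next
    case False
    then have "x > 0" using lo y(2) by linarith
    then have "real_of_int B \<le> x / u" using xz(2) u by simp
    then have "real_of_int B * u \<le> of_int \<lfloor>x / u\<rfloor> * u" using u by (simp add: le_floor_iff)
    then show ?thesis using False by linarith
  qed
  have up: "of_int \<lceil>x / u\<rceil> * u \<le> y" if y: "y \<in> fp_system p" "x \<le> y" for y
  proof (cases "real_of_int B * u \<le> \<bar>y\<bar>")
    case True
    then obtain k where k: "y = of_int k * u" using mult y(1) by blast
    then have "x / u \<le> real_of_int k" using y(2) u by (simp add: field_simps)
    then show ?thesis using k u by (simp add: ceiling_le_iff)
  next
    case False
    then have xn: "x < 0" using lo y(2) by linarith
    then have "x / u < 0" using u by (simp add: divide_neg_pos)
    then have "x / u \<le> real_of_int (- B)" using xz(2) by simp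
    then have "\<lceil>x / u\<rceil> \<le> - B" by (simp only: ceiling_le_iff)
    then have "of_int \<lceil>x / u\<rceil> * u \<le> real_of_int (- B) * u"
      using u by (intro mult_right_mono) linarith+
    then show ?thesis using False by simp
  qed
  have "of_int \<lfloor>x / u\<rfloor> * u \<le> x / u * u" using u by (intro mult_right_mono) auto
  then have "of_int \<lfloor>x / u\<rfloor> * u \<le> x" using u by simp
  then show "round_down p x = of_int \<lfloor>x / ulp p x\<rfloor> * ulp p x"
    unfolding round_down_def u_def[symmetric] using dn mem[OF kb(1)]
    by (intro Greatest_equality) auto
  have "x / u * u \<le> of_int \<lceil>x / u\<rceil> * u" using u by (intro mult_right_mono) auto
  then have "x \<le> of_int \<lceil>x / u\<rceil> * u" using u by simp
  then show "round_up p x = of_int \<lceil>x / ulp p x\<rceil> * ulp p x"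
    unfolding round_up_def u_def[symmetric] using up mem[OF kb(2)]
    by (intro Least_equality) auto
qed

lemma sr_prob_bounds:
  assumes p: "p \<ge> 1" and x: "x \<noteq> 0"
  shows "0 \<le> sr_prob p r x" "sr_prob p r x \<le> 1"
proof -
  define u where "u = ulp p x"
  define z where "z = \<bar>x\<bar> / u"
  have u: "u > 0" by (simp add: u_def ulp_def)
  have ep: "expo x - int p + 1 = expo x - int (p - 1)" using p by simp
  have ue: "2 powi expo x = u * 2 ^ (p - 1)"
    unfolding u_def ulp_def ep by (simp add: power_int_diff power_int_of_nat)
  have pr: "(2::real) ^ (p + r - 1) = 2 ^ (p - 1) * 2 ^ r"
    using p by (simp flip: power_add)
  have sz: "signif x * 2 ^ (p + r - 1) = z * 2 ^ r"
    unfolding signif_def z_def ue pr using u by (simp add: field_simps)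
  define w where "w = of_int \<lfloor>z * 2 ^ r\<rfloor> / (2::real) ^ r"
  have fl: "fl_trunc (p + r) x = sgn x * w * u"
    unfolding fl_trunc_def sz unfolding pr using x by (simp add: w_def ue field_simps)
  have q: "sr_prob p r x = sgn x * w - of_int \<lfloor>x / u\<rfloor>"
    unfolding sr_prob_def fl round_down_eq[OF p x] u_def[symmetric] using u
    by (simp add: field_simps)
  have w1: "w \<le> z" by (simp add: w_def pos_divide_le_eq)
  have "real_of_int (\<lfloor>z\<rfloor> * 2 ^ r) \<le> z * 2 ^ r" by simp
  then have "\<lfloor>z\<rfloor> * 2 ^ r \<le> \<lfloor>z * 2 ^ r\<rfloor>" by (simp only: le_floor_iff)
  then have "real_of_int (\<lfloor>z\<rfloor> * 2 ^ r) \<le> of_int \<lfloor>z * 2 ^ r\<rfloor>" by (simp only: of_int_le_iff)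
  then have w2: "of_int \<lfloor>z\<rfloor> \<le> w" by (simp add: w_def pos_le_divide_eq)
  have "0 \<le> sr_prob p r x \<and> sr_prob p r x \<le> 1"
  proof (cases "x > 0")
    case True
    then have "sgn x = 1" "x / u = z" by (simp_all add: z_def)
    then have "sr_prob p r x = w - of_int \<lfloor>z\<rfloor>" using q by simp
    then show ?thesis using w1 w2 by linarith
  next
    case False
    then have "sgn x = -1" "x / u = - z" using x by (simp_all add: z_def)
    then have "sr_prob p r x = of_int \<lceil>z\<rceil> - w" using q by (simp add: floor_minus)
    moreover have "z \<le> of_int \<lceil>z\<rceil>" "of_int \<lceil>z\<rceil> \<le> real_of_int \<lfloor>z\<rfloor> + 1"
      using ceiling_diff_floor_le_1[of z] by linarith+
    ultimately show ?thesis using w1 w2 by linarith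
  qed
  then show "0 \<le> sr_prob p r x" "sr_prob p r x \<le> 1" by auto
qed

end

theory Submission
  imports Defs
begin

text \<open>Write \<open>u = unit_roundoff (p + r)\<close>, \<open>c\<^sub>i = a\<^sub>i b\<^sub>i\<close> and \<open>S\<^sub>k = \<bar>c\<^sub>1\<bar> + \<dots> + \<bar>c\<^sub>k\<bar>\<close>.
  The mean of \<open>SR p r x\<close> is the truncation \<open>fl_trunc (p + r) x\<close> (\<open>expectation_SR\<close>), whose
  relative error is at most \<open>u\<close> (\<open>fl_trunc_error\<close>). Each rounding thus adds a bias of at most
  \<open>u\<close> times the mean absolute value of its argument, and what remains is to bound these means.
  Here two facts help: both candidates for the rounded value of \<open>x\<close> have the sign of \<open>x\<close>
  (or vanish), and truncation is towards zero. They give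
  \<open>E \<bar>SR p r x\<bar> = \<bar>E (SR p r x)\<bar> = \<bar>fl_trunc (p + r) x\<bar> \<le> \<bar>x\<bar>\<close> (\<open>expectation_abs_SR_le\<close>), so stochastic
  rounding does not increase mean absolute values, and all partial sums satisfy \<open>E \<bar>s\<^sub>k\<bar> \<le> S\<^sub>k\<close>.

  The rounding of the products contributes at most \<open>u * S\<^sub>n\<close> to the bias in total, and each of the
  \<open>n - 1\<close> additions at most \<open>u * S\<^sub>n\<close>. Hence the bias of the computed inner product is at most
  \<open>n * u * S\<^sub>n\<close> (\<open>sr_inner_moments\<close>), and \<open>n * u \<le> (1 + u)\<^sup>n - 1\<close> by Bernoulli's inequality.\<close>

section \<open>Truncation of the significand\<close>

lemma fl_trunc_eq:
  assumes "x \<noteq> 0" and "q \<ge> 1"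
  shows "fl_trunc q x = sgn x * of_int \<lfloor>\<bar>x\<bar> / ulp q x\<rfloor> * ulp q x"
proof -
  have e: "expo x - int q + 1 = expo x - int (q - 1)" using assms by simp
  have u: "ulp q x = 2 powi expo x / 2 ^ (q - 1)"
    unfolding ulp_def e by (simp add: power_int_diff power_int_of_nat)
  show ?thesis using assms by (simp add: fl_trunc_def signif_def u)
qed

lemma ulp_pos: "ulp q x > 0"
  by (simp add: ulp_def)

lemma ulp_le_unit_roundoff:
  assumes "x \<noteq> 0"
  shows "ulp q x \<le> unit_roundoff q * \<bar>x\<bar>"
proof -
  have "ulp q x = unit_roundoff q * 2 powi expo x"
    unfolding ulp_def unit_roundoff_def
    by (simp add: algebra_simps flip: power_int_add)
  also have "\<dots> \<le> unit_roundoff q * \<bar>x\<bar>"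
    using powi_expo_bounds(1)[OF assms] by (intro mult_left_mono) (simp_all add: unit_roundoff_def)
  finally show ?thesis .
qed

lemma
  assumes "q \<ge> 1"
  shows abs_fl_trunc_le: "\<bar>fl_trunc q x\<bar> \<le> \<bar>x\<bar>"
    and fl_trunc_error: "\<bar>fl_trunc q x - x\<bar> \<le> unit_roundoff q * \<bar>x\<bar>"
    and sgn_mult_fl_trunc: "sgn x * fl_trunc q x = \<bar>fl_trunc q x\<bar>"
proof -
  have "\<bar>fl_trunc q x\<bar> \<le> \<bar>x\<bar> \<and> \<bar>fl_trunc q x - x\<bar> \<le> unit_roundoff q * \<bar>x\<bar>
    \<and> sgn x * fl_trunc q x = \<bar>fl_trunc q x\<bar>"
  proof (cases "x = 0")
    case True
    then show ?thesis by (simp add: fl_trunc_def)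
  next
    case False
    define u where "u = ulp q x"
    define w where "w = of_int \<lfloor>\<bar>x\<bar> / u\<rfloor> * u"
    have u: "u > 0" by (simp add: u_def ulp_pos)
    have "of_int \<lfloor>\<bar>x\<bar> / u\<rfloor> * u \<le> \<bar>x\<bar> / u * u" using u by (intro mult_right_mono) auto
    then have le: "w \<le> \<bar>x\<bar>" using u by (simp add: w_def)
    have "\<bar>x\<bar> / u * u \<le> (of_int \<lfloor>\<bar>x\<bar> / u\<rfloor> + 1) * u" using u by (intro mult_right_mono) linarith+
    then have ge: "\<bar>x\<bar> - u \<le> w" using u by (simp add: w_def algebra_simps)
    have w0: "w \<ge> 0" using u by (simp add: w_def)
    have fl: "fl_trunc q x = sgn x * w"
      using fl_trunc_eq[OF False assms] by (simp add: w_def u_def)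
    have uu: "u \<le> unit_roundoff q * \<bar>x\<bar>"
      unfolding u_def by (rule ulp_le_unit_roundoff[OF False])
    show ?thesis
      using False le ge w0 uu by (cases "x > 0") (simp_all add: fl)
  qed
  then show "\<bar>fl_trunc q x\<bar> \<le> \<bar>x\<bar>" "\<bar>fl_trunc q x - x\<bar> \<le> unit_roundoff q * \<bar>x\<bar>"
    "sgn x * fl_trunc q x = \<bar>fl_trunc q x\<bar>" by auto
qed

section \<open>Moments of a single stochastic rounding\<close>

lemma finite_set_pmf_SR: "finite (set_pmf (SR p r x))"
  by (simp add: SR_def)

lemma expectation_SR:
  assumes p: "p \<ge> 1"
  shows "measure_pmf.expectation (SR p r x) (\<lambda>t. t) = fl_trunc (p + r) x"
proof (cases "x = 0")
  case True
  then show ?thesis by (simp add: SR_def fl_trunc_def)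
next
  case False
  define u where "u = ulp p x"
  have u: "u > 0" by (simp add: u_def ulp_pos)
  have q: "sr_prob p r x * u = fl_trunc (p + r) x - round_down p x"
    using u by (simp add: sr_prob_def u_def)
  have "measure_pmf.expectation (SR p r x) (\<lambda>t. t)
      = round_down p x + sr_prob p r x * (round_up p x - round_down p x)"
    using False sr_prob_bounds[OF p False, of r]
    by (simp add: SR_def algebra_simps)
  also have "\<dots> = fl_trunc (p + r) x"
  proof (cases "x / u \<in> \<int>")
    case True
    \<comment> \<open>The two candidates coincide with \<open>x\<close>, and \<open>p\<close> bits, hence also \<open>p + r\<close>, represent \<open>x\<close>.\<close>
    then obtain k where k: "x / u = of_int k" by (elim Ints_cases)
    have xk: "x = of_int k * u" using k u by (simp add: field_simps)
    have ur: "ulp (p + r) x = u / 2 ^ r"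
    proof -
      have "expo x - int (p + r) + 1 = (expo x - int p + 1) - int r" by simp
      then show ?thesis
        using power_int_diff[of "2::real" "expo x - int p + 1" "int r"]
        by (simp only: ulp_def u_def) (simp add: power_int_of_nat)
    qed
    have "\<bar>x\<bar> / ulp (p + r) x = of_int (\<bar>k\<bar> * 2 ^ r)"
      unfolding ur using u by (simp add: xk abs_mult)
    then have "fl_trunc (p + r) x = sgn x * of_int (\<bar>k\<bar> * 2 ^ r) * ulp (p + r) x"
      using fl_trunc_eq[OF False, of "p + r"] p by simp
    also have "\<dots> = sgn x * \<bar>x\<bar>"
      unfolding ur using u by (simp add: xk abs_mult)
    finally have "fl_trunc (p + r) x = x" by (simp add: sgn_mult_abs)
    moreover have "round_down p x = x" "round_up p x = x"
      unfolding round_down_eq[OF p False] round_up_eq[OF p False] u_def[symmetric] k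
      by (simp_all flip: xk)
    ultimately show ?thesis by simp
  next
    case False
    then have "\<lceil>x / u\<rceil> = \<lfloor>x / u\<rfloor> + 1"
      by (simp add: ceiling_altdef) (metis Ints_of_int)
    then have "round_up p x - round_down p x = u"
      using round_down_eq[OF p \<open>x \<noteq> 0\<close>] round_up_eq[OF p \<open>x \<noteq> 0\<close>]
      by (simp add: algebra_simps flip: u_def)
    then show ?thesis using q by simp
  qed
  finally show ?thesis .
qed

text \<open>Stochastic rounding preserves signs, up to the value \<open>0\<close>.\<close>

lemma abs_eq_sgn_mult_SR:
  assumes p: "p \<ge> 1" and t: "t \<in> set_pmf (SR p r x)"
  shows "\<bar>t\<bar> = sgn x * t"
proof (cases "x = 0")
  case True
  then show ?thesis using t by (simp add: SR_def)
next
  case False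
  define u where "u = ulp p x"
  have u: "u > 0" by (simp add: u_def ulp_pos)
  have "t = of_int \<lfloor>x / u\<rfloor> * u \<or> t = of_int \<lceil>x / u\<rceil> * u"
    using t False round_down_eq[OF p False] round_up_eq[OF p False]
    by (auto simp: SR_def u_def split: if_splits)
  then obtain k where k: "t = of_int k * u" "k = \<lfloor>x / u\<rfloor> \<or> k = \<lceil>x / u\<rceil>" by blast
  show ?thesis
  proof (cases "x > 0")
    case True
    then have "x / u > 0" using u by simp
    then have "k \<ge> 0" using k(2) by linarith
    then show ?thesis using True u by (simp add: k(1))
  next
    case neg: False
    then have "x / u < 0" using u False by (simp add: divide_neg_pos)
    then have "k \<le> 0" using k(2) by linarith
    then show ?thesis using neg False u by (simp add: k(1) abs_mult)
  qed
qed

lemma expectation_abs_SR_le: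
  assumes p: "p \<ge> 1"
  shows "measure_pmf.expectation (SR p r x) (\<lambda>t. \<bar>t\<bar>) \<le> \<bar>x\<bar>"
proof -
  have "measure_pmf.expectation (SR p r x) (\<lambda>t. \<bar>t\<bar>)
      = measure_pmf.expectation (SR p r x) (\<lambda>t. sgn x * t)"
    using abs_eq_sgn_mult_SR[OF p]
    by (intro integral_cong_AE) (auto simp: AE_measure_pmf_iff)
  also have "\<dots> = \<bar>fl_trunc (p + r) x\<bar>"
    using p by (simp add: expectation_SR sgn_mult_fl_trunc)
  also have "\<dots> \<le> \<bar>x\<bar>" using p by (simp add: abs_fl_trunc_le)
  finally show ?thesis .
qed

section \<open>Propagation through the summation\<close>

lemma expectation_bind_pmf_finite:
  fixes f :: "'b \<Rightarrow> real"
  assumes "finite (set_pmf P)" and "\<And>x. finite (set_pmf (K x))"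
  shows "measure_pmf.expectation (bind_pmf P K) f
    = measure_pmf.expectation P (\<lambda>x. measure_pmf.expectation (K x) f)"
  using assms by (subst pmf_expectation_bind[where A = "set_pmf P"])
    (auto simp: integral_measure_pmf[where A = "set_pmf P"])

lemma expectation_pair_pmf_add:
  fixes f g :: "real \<Rightarrow> real"
  assumes "finite (set_pmf P)" "finite (set_pmf Q)"
  shows "measure_pmf.expectation (pair_pmf P Q) (\<lambda>z. f (fst z) + g (snd z))
    = measure_pmf.expectation P f + measure_pmf.expectation Q g"
proof -
  have "measure_pmf.expectation (pair_pmf P Q) (\<lambda>z. f (fst z) + g (snd z))
    = measure_pmf.expectation (pair_pmf P Q) (\<lambda>z. f (fst z))
      + measure_pmf.expectation (pair_pmf P Q) (\<lambda>z. g (snd z))"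
    using assms by (intro Bochner_Integration.integral_add integrable_measure_pmf_finite) auto
  then show ?thesis by simp
qed

lemma finite_set_pmf_sr_inner: "finite (set_pmf (sr_inner p r a b n))"
  by (induction p r a b n rule: sr_inner.induct) (auto simp: finite_set_pmf_SR)

text \<open>One addition of independent summands with laws \<open>P\<close> and \<open>Q\<close>, followed by rounding: the mean
  absolute value is subadditive, and the bias is at most \<open>u\<close> times its bound.\<close>

lemma SR_add_moments:
  fixes P Q :: "real pmf" and p r :: nat
  assumes p: "p \<ge> 1" and fin: "finite (set_pmf P)" "finite (set_pmf Q)"
  defines "R \<equiv> bind_pmf P (\<lambda>s. bind_pmf Q (\<lambda>t. SR p r (s + t)))"
    and "M \<equiv> measure_pmf.expectation P (\<lambda>s. \<bar>s\<bar>) + measure_pmf.expectation Q (\<lambda>t. \<bar>t\<bar>)"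
  shows "measure_pmf.expectation R (\<lambda>s. \<bar>s\<bar>) \<le> M"
    and "\<bar>measure_pmf.expectation R (\<lambda>s. s)
      - (measure_pmf.expectation P (\<lambda>s. s) + measure_pmf.expectation Q (\<lambda>t. t))\<bar>
      \<le> unit_roundoff (p + r) * M"
proof -
  define Z where "Z = pair_pmf P Q"
  have finZ: "finite (set_pmf Z)" using fin by (simp add: Z_def)
  note int = integrable_measure_pmf_finite[OF finZ]
  have R: "R = bind_pmf Z (\<lambda>z. SR p r (fst z + snd z))"
    by (simp add: R_def Z_def pair_pmf_def bind_assoc_pmf bind_return_pmf)
  have ER: "measure_pmf.expectation R f
      = measure_pmf.expectation Z (\<lambda>z. measure_pmf.expectation (SR p r (fst z + snd z)) f)"
    for f :: "real \<Rightarrow> real"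
    unfolding R by (intro expectation_bind_pmf_finite finZ finite_set_pmf_SR)
  have M: "M = measure_pmf.expectation Z (\<lambda>z. \<bar>fst z\<bar> + \<bar>snd z\<bar>)"
    unfolding M_def Z_def
    by (rule expectation_pair_pmf_add[OF fin, symmetric])
  have absM: "measure_pmf.expectation Z (\<lambda>z. \<bar>fst z + snd z\<bar>) \<le> M"
    unfolding M by (intro integral_mono int) auto
  show "measure_pmf.expectation R (\<lambda>s. \<bar>s\<bar>) \<le> M"
    unfolding ER
    by (intro order.trans[OF integral_mono absM] int expectation_abs_SR_le p)
  have "measure_pmf.expectation R (\<lambda>s. s)
      - (measure_pmf.expectation P (\<lambda>s. s) + measure_pmf.expectation Q (\<lambda>t. t))
      = measure_pmf.expectation Z (\<lambda>z. fl_trunc (p + r) (fst z + snd z))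
        - measure_pmf.expectation Z (\<lambda>z. fst z + snd z)"
    unfolding ER expectation_SR[OF p] Z_def
    by (simp add: expectation_pair_pmf_add[OF fin, of "\<lambda>s. s" "\<lambda>t. t"])
  also have "\<dots> = measure_pmf.expectation Z
      (\<lambda>z. fl_trunc (p + r) (fst z + snd z) - (fst z + snd z))"
    by (intro Bochner_Integration.integral_diff[symmetric] int)
  also have "\<bar>\<dots>\<bar> \<le> measure_pmf.expectation Z
      (\<lambda>z. \<bar>fl_trunc (p + r) (fst z + snd z) - (fst z + snd z)\<bar>)"
    by (rule integral_abs_bound)
  also have "\<dots> \<le> measure_pmf.expectation Z (\<lambda>z. unit_roundoff (p + r) * \<bar>fst z + snd z\<bar>)"
    using p by (intro integral_mono int fl_trunc_error) simp
  also have "\<dots> = unit_roundoff (p + r) * measure_pmf.expectation Z (\<lambda>z. \<bar>fst z + snd z\<bar>)"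
    by simp
  also have "\<dots> \<le> unit_roundoff (p + r) * M"
    using absM by (intro mult_left_mono) (simp_all add: unit_roundoff_def)
  finally show "\<bar>measure_pmf.expectation R (\<lambda>s. s)
      - (measure_pmf.expectation P (\<lambda>s. s) + measure_pmf.expectation Q (\<lambda>t. t))\<bar>
      \<le> unit_roundoff (p + r) * M" .
qed

lemma sr_inner_moments:
  fixes a b :: "nat \<Rightarrow> real"
  assumes p: "p \<ge> 1"
  defines "S \<equiv> \<lambda>n. \<Sum>i=1..n. \<bar>a i * b i\<bar>"
  shows "measure_pmf.expectation (sr_inner p r a b n) (\<lambda>s. \<bar>s\<bar>) \<le> S n \<and>
    \<bar>measure_pmf.expectation (sr_inner p r a b n) (\<lambda>s. s) - (\<Sum>i=1..n. a i * b i)\<bar>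
      \<le> real n * unit_roundoff (p + r) * S n"
proof (induction n rule: induct_nat_012)
  case 0
  then show ?case by (simp add: S_def)
next
  case 1
  show ?case
    using p fl_trunc_error[of "p + r" "a 1 * b 1"]
    by (simp add: S_def expectation_SR expectation_abs_SR_le)
next
  case (ge2 k)
  define u where "u = unit_roundoff (p + r)"
  define c where "c = a (Suc (Suc k)) * b (Suc (Suc k))"
  define P where "P = sr_inner p r a b (Suc k)"
  define R where "R = sr_inner p r a b (Suc (Suc k))"
  define y where "y = (\<Sum>i=1..Suc k. a i * b i)"
  have u: "u \<ge> 0" by (simp add: u_def unit_roundoff_def)
  have S: "S (Suc (Suc k)) = S (Suc k) + \<bar>c\<bar>" by (simp add: S_def c_def)
  have y: "(\<Sum>i=1..Suc (Suc k). a i * b i) = y + c" by (simp add: y_def c_def)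
  have IH: "measure_pmf.expectation P (\<lambda>s. \<bar>s\<bar>) \<le> S (Suc k)"
    "\<bar>measure_pmf.expectation P (\<lambda>s. s) - y\<bar> \<le> real (Suc k) * u * S (Suc k)"
    using ge2(2) by (simp_all only: P_def y_def u_def)
  have t: "measure_pmf.expectation (SR p r c) (\<lambda>t. \<bar>t\<bar>) \<le> \<bar>c\<bar>"
    "\<bar>measure_pmf.expectation (SR p r c) (\<lambda>t. t) - c\<bar> \<le> u * \<bar>c\<bar>"
    using p by (simp_all add: u_def expectation_SR expectation_abs_SR_le fl_trunc_error)
  have R: "R = bind_pmf P (\<lambda>s. bind_pmf (SR p r c) (\<lambda>t. SR p r (s + t)))"
    by (simp add: R_def P_def c_def)
  have fin: "finite (set_pmf P)" "finite (set_pmf (SR p r c))"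
    by (simp_all add: P_def finite_set_pmf_sr_inner finite_set_pmf_SR)
  note add = SR_add_moments[where r = r, OF p fin, folded R u_def]
  have M: "measure_pmf.expectation P (\<lambda>s. \<bar>s\<bar>) + measure_pmf.expectation (SR p r c) (\<lambda>t. \<bar>t\<bar>)
      \<le> S (Suc k) + \<bar>c\<bar>"
    using IH(1) t(1) by linarith
  have "\<bar>measure_pmf.expectation R (\<lambda>s. s)
      - (measure_pmf.expectation P (\<lambda>s. s) + measure_pmf.expectation (SR p r c) (\<lambda>t. t))\<bar>
      \<le> u * (S (Suc k) + \<bar>c\<bar>)"
    using add(2) mult_left_mono[OF M u] by linarith
  then have "\<bar>measure_pmf.expectation R (\<lambda>s. s) - (y + c)\<bar>
      \<le> u * (S (Suc k) + \<bar>c\<bar>) + real (Suc k) * u * S (Suc k) + u * \<bar>c\<bar>"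
    using IH(2) t(2) by linarith
  \<comment> \<open>The new product is rounded twice, which accounts for \<open>2 * u * \<bar>c\<bar> \<le> (k + 2) * u * \<bar>c\<bar>\<close>.\<close>
  also have "\<dots> \<le> real (Suc (Suc k)) * u * (S (Suc k) + \<bar>c\<bar>)"
    using u by (simp add: algebra_simps)
  finally show ?case
    using add(1) M unfolding S y by (fold R_def u_def) linarith
qed

theorem theorem5:
  fixes p r n :: nat and a b :: "nat \<Rightarrow> real" and y :: real
  assumes "p \<ge> 1" and "r \<ge> 1" and "n \<ge> 1"
    and "y = (\<Sum>i=1..n. a i * b i)" and "y \<noteq> 0"
  shows "\<bar>measure_pmf.expectation (sr_inner p r a b n) (\<lambda>yhat. yhat) - y\<bar> / \<bar>y\<bar>
         \<le> cond_number n (hadamard a b) * gamma_err n (unit_roundoff (p + r))"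
proof -
  define u where "u = unit_roundoff (p + r)"
  define S where "S = (\<Sum>i=1..n. \<bar>a i * b i\<bar>)"
  have "u \<ge> 0" by (simp add: u_def unit_roundoff_def)
  then have "real n * u \<le> gamma_err n u"
    using Bernoulli_inequality[of u n] by (simp add: gamma_err_def)
  moreover have "S \<ge> 0" unfolding S_def by (intro sum_nonneg) simp
  ultimately have "real n * u * S \<le> gamma_err n u * S" by (intro mult_right_mono)
  moreover have "\<bar>measure_pmf.expectation (sr_inner p r a b n) (\<lambda>yhat. yhat) - y\<bar> \<le> real n * u * S"
    using sr_inner_moments[OF assms(1), of r a b n] assms(4) by (simp add: S_def u_def)
  ultimately have "\<bar>measure_pmf.expectation (sr_inner p r a b n) (\<lambda>yhat. yhat) - y\<bar> / \<bar>y\<bar>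
      \<le> gamma_err n u * S / \<bar>y\<bar>"
    by (intro divide_right_mono) auto
  also have "\<dots> = cond_number n (hadamard a b) * gamma_err n u"
    using assms(4) by (simp add: cond_number_def hadamard_def S_def)
  finally show ?thesis by (simp only: u_def)
qed

end
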